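(* Let $q$ be a prime power and define $h:\mathbb{F}_{q^3}^*\to\mathbb{F}_{q^3}$ by $h(x)=(1+x^2)\,\mathrm{Tr}_{q^3/q}\!\left(\frac1x\right)-x$. Then $h$ is a permutation of $\mathbb{F}_{q^3}^*$ (i.e., a bijection $\mathbb{F}_{q^3}^*\to\mathbb{F}_{q^3}^*$) if and only if $q=3$.
   Context: $\mathrm{Tr}_{q^3/q}(y)=y+y^q+y^{q^2}$ is the trace from $\mathbb{F}_{q^3}$ to $\mathbb{F}_q$. *)

theory Defs
  imports "HOL-Number_Theory.Number_Theory" "HOL-Number_Theory.Prime_Powers"
begin

(* The field of order q ^ 3 is a type 'a :: {field, finite} with CARD('a) = q ^ 3; its subfield
   of order q is {x. x ^ q = x}.  The trace is regarded as an element of 'a. *)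

definition trace_q3_q :: "nat \<Rightarrow> 'a::field \<Rightarrow> 'a" where
  "trace_q3_q q y = y + y ^ q + y ^ (q ^ 2)"

(* Only the values at x \<noteq> 0 are meaningful. *)
definition h :: "nat \<Rightarrow> 'a::field \<Rightarrow> 'a" where
  "h q x = (1 + x ^ 2) * trace_q3_q q (1 / x) - x"

end

theory Submission
  imports Defs "HOL-Computational_Algebra.Polynomial"
begin

text \<open>
  If \<open>1/x\<close> has trace 0, then \<open>h x = - x\<close>. So \<open>h\<close> is not injective as soon
  as some \<open>x\<close> whose inverse has nonzero trace \<open>t\<close> satisfies \<open>Tr (1 / h x) =
  0\<close>. Writing \<open>1/x = t y\<close> with \<open>Tr y = 1\<close>, this is one polynomial equation in
  \<open>t\<^sup>2\<close> and the symmetric functions of the conjugates of \<open>y\<close>; let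
  \<open>E\<close> be the second one and \<open>N\<close> the norm. In characteristic 2 it reads
  \<open>t\<^sup>4 N\<^sup>2 = E + 1\<close>, so every \<open>y\<close> of trace 1 with \<open>E \<noteq>
  1\<close> gives a collision. In characteristic 3, take \<open>u\<close> with \<open>u\<^sup>q = u + 1\<close>
  and \<open>y = c - u\<^sup>2\<close>: if \<open>-1\<close> is a square, then \<open>t\<^sup>4 = -1\<close>,
  \<open>c = - t\<^sup>2\<close> is a solution; otherwise one of \<open>c = 0\<close>, \<open>c = 1\<close>
  works, unless \<open>q = 3\<close>. In characteristic at least 5 simply \<open>h 1 = h (3/2)\<close>. For
  \<open>q = 3\<close>, \<open>h\<close> is odd and \<open>h x = (1 + x)\<^sup>2\<close> when \<open>1/x\<close>
  has trace 1, and the symmetric functions of \<open>x\<close> only take the values \<open>0\<close>,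
  \<open>1\<close>, \<open>-1\<close>.
\<close>

section \<open>Counting tools and one symmetric-function identity\<close>

lemma finite_field_power_card_minus_1:
  fixes x :: "'a::{field,finite}"
  assumes "x \<noteq> 0"
  shows "x ^ (card (UNIV :: 'a set) - 1) = 1"
proof -
  let ?P = "\<Prod>y\<in>UNIV - {0::'a}. y"
  have "(\<Prod>y\<in>UNIV - {0}. x * y) = ?P"
    by (rule prod.reindex_bij_witness[of _ "\<lambda>y. y / x" "\<lambda>y. x * y"]) (use assms in auto)
  then have "x ^ (card (UNIV :: 'a set) - 1) * ?P = 1 * ?P"
    by (simp add: prod.distrib card_Diff_subset)
  moreover have "?P \<noteq> 0" by simp
  ultimately show ?thesis using mult_right_cancel by blast
qed

lemma card_roots_le:
  fixes p :: "'a::{comm_ring_1,ring_no_zero_divisors} poly"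
  assumes "p \<noteq> 0" "\<And>x. x \<in> A \<Longrightarrow> poly p x = 0"
  shows "card A \<le> degree p"
proof -
  have "card A \<le> card {x. poly p x = 0}"
    using assms by (intro card_mono poly_roots_finite) auto
  also have "\<dots> \<le> degree p"
    by (rule card_poly_roots_bound) fact
  finally show ?thesis .
qed

text \<open>Serves the map \<open>u^q - u\<close> twice: small fibres force a large image, and a
  known image forces a large fibre.\<close>

lemma card_UNIV_le_range:
  fixes f :: "'a::finite \<Rightarrow> 'b"
  assumes "\<And>x. card {u. f u = f x} \<le> n"
  shows "card (UNIV :: 'a set) \<le> card (range f) * n"
proof -
  have "card (UNIV :: 'a set) = card (\<Union>v\<in>range f. {u. f u = v})"
    by (rule arg_cong[of _ _ card]) auto
  also have "\<dots> \<le> (\<Sum>v\<in>range f. card {u. f u = v})"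
    by (intro card_UN_le) auto
  also have "\<dots> \<le> card (range f) * n"
    using sum_bounded_above[of "range f" "\<lambda>v. card {u. f u = v}" n] assms by auto
  finally show ?thesis .
qed

text \<open>The left side is the numerator of the trace of \<open>y^2 / (s * y^2 + 1 - y)\<close>
  over the common denominator, the \<open>yi\<close> being the conjugates of an element of trace 1;
  \<open>s\<close> will be \<open>t^2\<close>.\<close>

lemma conjugate_sum_eq:
  fixes s y1 y2 y3 :: "'a::comm_ring_1"
  assumes "y1 + y2 + y3 = 1"
    and "E = y1 * y2 + y1 * y3 + y2 * y3" and "N = y1 * y2 * y3"
  shows "y1\<^sup>2 * (s * y2\<^sup>2 + 1 - y2) * (s * y3\<^sup>2 + 1 - y3)
       + y2\<^sup>2 * (s * y3\<^sup>2 + 1 - y3) * (s * y1\<^sup>2 + 1 - y1)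
       + y3\<^sup>2 * (s * y1\<^sup>2 + 1 - y1) * (s * y2\<^sup>2 + 1 - y2)
       = 3 * s\<^sup>2 * N\<^sup>2 + 2 * s * (E\<^sup>2 - 2 * N - N * E) + 1 - 3 * E + 4 * N"
proof -
  have y3: "y3 = 1 - y1 - y2" using assms(1) by (simp add: algebra_simps)
  show ?thesis unfolding assms(2,3) y3
    by (simp add: algebra_simps power2_eq_square)
qed

section \<open>Frobenius and trace in the cubic extension\<close>

locale cubic_extension =
  fixes q :: nat and ty :: "'a::{field,finite} itself"
  assumes primepow_q: "primepow q" and card_UNIV: "card (UNIV :: 'a set) = q ^ 3"
begin

abbreviation tr :: "'a \<Rightarrow> 'a" where "tr \<equiv> trace_q3_q q"

lemma q_gt_1: "1 < q"
  using primepow_q primepow_gt_Suc_0 by auto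

lemma prime_CHAR: "prime CHAR('a)"
  using prime_CHAR_semidom finite_imp_CHAR_pos[where ?'a = 'a] by simp

lemma q_CHAR_power: "\<exists>k>0. q = CHAR('a) ^ k"
proof -
  obtain p k where pk: "prime p" "k > 0" "q = p ^ k"
    using primepow_q by (auto simp: primepow_def)
  have "CHAR('a) dvd p ^ (k * 3)"
    using CHAR_dvd_CARD[where ?'a = 'a] card_UNIV pk by (simp add: power_mult)
  then have "CHAR('a) = p"
    using prime_CHAR pk(1) prime_dvd_power primes_dvd_imp_eq by blast
  then show ?thesis using pk by auto
qed

lemma frob_add: "(x + y :: 'a) ^ q = x ^ q + y ^ q"
  using q_CHAR_power freshmans_dream'[OF prime_CHAR] by metis

lemma frob_minus: "(- x :: 'a) ^ q = - (x ^ q)"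
proof -
  have "x ^ q + (- x) ^ q = 0"
    using frob_add[of x "- x"] q_gt_1 by (simp add: power_0_left)
  then show ?thesis by (simp add: eq_neg_iff_add_eq_0 add.commute)
qed

lemma frob_diff: "(x - y :: 'a) ^ q = x ^ q - y ^ q"
  using frob_add[of x "- y"] frob_minus by simp

lemma frob_of_nat: "(of_nat n :: 'a) ^ q = of_nat n"
  using q_gt_1 by (induction n) (auto simp: frob_add)

lemma frob_numeral [simp]: "(numeral n :: 'a) ^ q = numeral n"
  using frob_of_nat[of "numeral n"] by simp

lemmas frob = frob_add frob_minus frob_diff power_mult_distrib

lemma frob_power: "((x :: 'a) ^ n) ^ q = (x ^ q) ^ n"
  by (simp add: power_mult [symmetric] mult.commute)

lemma frob_frob: "((x :: 'a) ^ q) ^ q = x ^ q\<^sup>2"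
  by (simp add: power_mult [symmetric] power2_eq_square)

lemma power_q_cubed: "(x :: 'a) ^ q ^ 3 = x"
proof (cases "x = 0")
  case False
  have "x ^ q ^ 3 = x ^ (q ^ 3 - 1) * x"
    using q_gt_1 by (metis One_nat_def Suc_pred power_Suc2 zero_less_power gr_zeroI not_less_zero)
  then show ?thesis
    using finite_field_power_card_minus_1[OF False] card_UNIV by simp
qed (use q_gt_1 in auto)

lemma frob_cubed: "(((x :: 'a) ^ q) ^ q) ^ q = x"
  using power_q_cubed[of x] by (simp add: power_mult [symmetric] power3_eq_cube)

lemma tr_conjugates: "tr y = y + y ^ q + (y ^ q) ^ q"
  by (simp add: trace_q3_q_def frob_frob)

lemma tr_zero [simp]: "tr 0 = 0"
  using q_gt_1 by (simp add: trace_q3_q_def power_0_left)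

lemma tr_minus: "tr (- y) = - tr y"
  by (simp add: tr_conjugates frob)

lemma tr_scale: "t ^ q = t \<Longrightarrow> tr (t * y) = t * tr y"
  by (simp add: tr_conjugates frob algebra_simps)

text \<open>The trace is a nonzero polynomial of degree \<open>q^2\<close>.\<close>

lemma card_ker_tr_le: "card {y. tr y = 0} \<le> q\<^sup>2"
proof -
  let ?p = "monom 1 (q\<^sup>2) + monom 1 q + monom 1 1 :: 'a poly"
  have "q < q\<^sup>2" using q_gt_1 by (simp add: power2_eq_square)
  then have "coeff ?p (q\<^sup>2) = 1" using q_gt_1 by (auto simp: less_imp_neq)
  then have "?p \<noteq> 0" by (metis coeff_0 zero_neq_one)
  then have "card {y. tr y = 0} \<le> degree ?p"
    by (rule card_roots_le) (simp add: trace_q3_q_def poly_monom algebra_simps)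
  also have "\<dots> \<le> q\<^sup>2"
    using \<open>q < q\<^sup>2\<close> q_gt_1
    by (intro degree_add_le) (auto intro: order.trans[OF degree_monom_le])
  finally show ?thesis .
qed

text \<open>Additive Hilbert 90, by counting: the fibres of \<open>u \<mapsto> u\<^sup>q - u\<close> have at most \<open>q\<close> elements.\<close>

lemma ker_tr: "{y. tr y = 0} = range (\<lambda>u. u ^ q - u)" and card_ker_tr: "card {y. tr y = 0} = q\<^sup>2"
proof -
  let ?f = "\<lambda>u :: 'a. u ^ q - u"
  have sub: "range ?f \<subseteq> {y. tr y = 0}"
    by (auto simp: tr_conjugates frob_diff frob_cubed)
  have fibre: "card {u. ?f u = v} \<le> q" for v
  proof -
    let ?p = "monom 1 q - monom 1 1 - [:v:]"
    have "coeff ?p q = 1" using q_gt_1 by (auto simp: coeff_pCons split: nat.splits)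
    then have "?p \<noteq> 0" by (metis coeff_0 zero_neq_one)
    then have "card {u. ?f u = v} \<le> degree ?p"
      by (rule card_roots_le) (auto simp: poly_monom)
    also have "\<dots> \<le> q"
      using q_gt_1
      by (intro degree_diff_le) (auto intro: order.trans[OF degree_monom_le])
    finally show ?thesis .
  qed
  have "q ^ 3 \<le> card (range ?f) * q"
    unfolding card_UNIV [symmetric] by (rule card_UNIV_le_range) (rule fibre)
  then have "q\<^sup>2 \<le> card (range ?f)"
    using q_gt_1 by (simp add: power2_eq_square power3_eq_cube)
  then show "{y. tr y = 0} = range ?f"
    using card_seteq[OF _ sub] card_ker_tr_le by simp
  then show "card {y. tr y = 0} = q\<^sup>2"
    using \<open>q\<^sup>2 \<le> card (range ?f)\<close> card_ker_tr_le by simp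
qed

text \<open>On the nonzero elements whose inverse has trace 0, \<open>h\<close> is negation; by injectivity no other
  element can be mapped into this set.\<close>

lemma tr_inverse_h_nonzero:
  assumes "bij_betw (h q :: 'a \<Rightarrow> 'a) (UNIV - {0}) (UNIV - {0})" "x \<noteq> 0" "tr (1 / x) \<noteq> 0"
  shows "h q x \<noteq> 0" "tr (1 / h q x) \<noteq> 0"
proof -
  show nz: "h q x \<noteq> 0"
    using assms(1,2) bij_betwE by blast
  show "tr (1 / h q x) \<noteq> 0"
  proof
    assume tr0: "tr (1 / h q x) = 0"
    have "tr (1 / - h q x) = 0"
      using tr_minus[of "1 / h q x"] tr0 by simp
    then have "h q (- h q x) = h q x"
      by (subst h_def) simp
    moreover have "inj_on (h q) (UNIV - {0 :: 'a})"
      using assms(1) by (simp add: bij_betw_def)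
    ultimately have "- h q x = x"
      using inj_onD[of "h q" "UNIV - {0 :: 'a}" "- h q x" x] assms(2) nz by simp
    with \<open>tr (1 / - h q x) = 0\<close> show False using assms(3) by metis
  qed
qed

section \<open>Criterion for a collision\<close>

text \<open>For \<open>x = 1 / (t * y)\<close> the inverse has trace \<open>t\<close>, and
  \<open>h q x = (t^2 * y^2 + 1 - y) / (t * y^2)\<close>. By \<open>conjugate_sum_eq\<close>,
  \<open>eq\<close> says that \<open>1 / h q x\<close> has trace 0, which
  \<open>tr_inverse_h_nonzero\<close> excludes for a bijection.\<close>

lemma not_bij_hI:
  assumes y: "tr y = 1" and t: "t \<noteq> 0" "t ^ q = t"
    and E: "E = y * y ^ q + y * (y ^ q) ^ q + y ^ q * (y ^ q) ^ q"
    and N: "N = y * y ^ q * (y ^ q) ^ q"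
    and eq: "3 * (t\<^sup>2)\<^sup>2 * N\<^sup>2 + 2 * t\<^sup>2 * (E\<^sup>2 - 2 * N - N * E) + 1 - 3 * E + 4 * N = 0"
  shows "\<not> bij_betw (h q :: 'a \<Rightarrow> 'a) (UNIV - {0}) (UNIV - {0})"
proof
  assume bij: "bij_betw (h q :: 'a \<Rightarrow> 'a) (UNIV - {0}) (UNIV - {0})"
  define d where "d z = t\<^sup>2 * z\<^sup>2 + 1 - z" for z
  have d_frob: "d z ^ q = d (z ^ q)" for z
    by (simp add: d_def frob frob_power t)
  have y0: "y \<noteq> 0" using y by auto
  define x where "x = 1 / (t * y)"
  have x: "x \<noteq> 0" "tr (1 / x) = t"
    using y0 t y by (simp_all add: x_def tr_scale)
  have hx: "h q x = d y / (t * y\<^sup>2)"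
    unfolding h_def x(2) unfolding x_def d_def using t(1) y0
    by (simp add: field_simps power2_eq_square)
  \<comment> \<open>A zero here would make \<open>h q x\<close> zero; Frobenius carries nonvanishing
    to the conjugates.\<close>
  have "d y \<noteq> 0"
    using tr_inverse_h_nonzero(1)[OF bij x(1)] x(2) t(1) hx by auto
  then have nz: "d y \<noteq> 0" "d (y ^ q) \<noteq> 0" "d ((y ^ q) ^ q) \<noteq> 0"
    by (simp_all flip: d_frob)
  have "tr (1 / h q x) = t * tr (y\<^sup>2 / d y)"
    using tr_scale[OF t(2), of "y\<^sup>2 / d y"] by (simp add: hx)
  also have "tr (y\<^sup>2 / d y) =
      y\<^sup>2 / d y + (y ^ q)\<^sup>2 / d (y ^ q) + ((y ^ q) ^ q)\<^sup>2 / d ((y ^ q) ^ q)"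
    by (simp only: tr_conjugates power_divide frob_power [of _ 2] d_frob)
  also have "\<dots> = 0"
  proof -
    have sum0: "y\<^sup>2 * d (y ^ q) * d ((y ^ q) ^ q) + (y ^ q)\<^sup>2 * d ((y ^ q) ^ q) * d y
        + ((y ^ q) ^ q)\<^sup>2 * d y * d (y ^ q) = 0"
      using conjugate_sum_eq[OF y [unfolded tr_conjugates] E N, of "t\<^sup>2"] eq
      by (simp only: d_def)
    have "a / d1 + b / d2 + c / d3 = (a * d2 * d3 + b * d3 * d1 + c * d1 * d2) / (d1 * d2 * d3)"
      if "d1 \<noteq> 0" "d2 \<noteq> 0" "d3 \<noteq> 0" for a b c d1 d2 d3 :: 'a
      using that by (simp add: field_simps)
    then show ?thesis using nz sum0 by simp
  qed
  finally show False
    using tr_inverse_h_nonzero(2)[OF bij x(1)] x(2) t(1) by simp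
qed

section \<open>Characteristic 2\<close>

lemma not_bij_h_char_2:
  assumes two: "(2 :: 'a) = 0"
  shows "\<not> bij_betw (h q :: 'a \<Rightarrow> 'a) (UNIV - {0}) (UNIV - {0})"
proof -
  have even: "even q"
  proof -
    have "CHAR('a) dvd 2"
      using two of_nat_eq_0_iff_char_dvd[of 2, where ?'a = 'a] by simp
    then have "CHAR('a) = 2"
      using prime_CHAR two_is_prime_nat primes_dvd_imp_eq by blast
    then show ?thesis using q_CHAR_power by auto
  qed
  \<comment> \<open>The last expression is \<open>(w^2 + w * w1 + w1^2) / w^2\<close> with
    \<open>w1 = w^q\<close>. It cannot vanish on all \<open>(q - 1) * (q + 1)\<close> nonzero
    elements of trace 0, since its degree is only \<open>2 * (q - 1)\<close>.\<close>
  obtain w :: 'a where w: "tr w = 0" "w \<noteq> 0" "w ^ (2 * (q - 1)) + w ^ (q - 1) + 1 \<noteq> 0"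
  proof (rule ccontr)
    assume "\<not> thesis"
    then have *: "\<And>w. w \<in> {y. tr y = 0} - {0} \<Longrightarrow> w ^ (2 * (q - 1)) + w ^ (q - 1) + 1 = 0"
      using that by blast
    let ?p = "monom 1 (2 * (q - 1)) + monom 1 (q - 1) + 1 :: 'a poly"
    have "coeff ?p 0 = 1" using q_gt_1 by simp
    then have "?p \<noteq> 0" by (metis coeff_0 zero_neq_one)
    then have "card ({y. tr y = 0} - {0}) \<le> degree ?p"
      by (rule card_roots_le) (use * in \<open>simp add: poly_monom\<close>)
    also have "\<dots> \<le> 2 * (q - 1)"
      by (intro degree_add_le) (auto intro: order.trans[OF degree_monom_le])
    also have "card ({y. tr y = 0} - {0}) = q\<^sup>2 - 1"
      by (simp add: card_Diff_subset card_ker_tr)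
    also have "q\<^sup>2 - 1 = (q - 1) * (q + 1)"
      using q_gt_1 by (cases q) (auto simp: power2_eq_square)
    finally have "(q - 1) * (q + 1) \<le> (q - 1) * 2" by (simp only: mult.commute)
    then show False using q_gt_1 by (simp only: mult_le_cancel1) simp
  qed
  define w1 w2 where "w1 = w ^ q" and "w2 = w1 ^ q"
  have sum: "w2 = - w - w1"
    using w(1) unfolding tr_conjugates w1_def [symmetric] w2_def [symmetric]
    by (metis add.commute diff_conv_add_uminus eq_neg_iff_add_eq_0 minus_add_distrib)
  have "w1 = w * w ^ (q - 1)"
    unfolding w1_def using q_gt_1 power_minus_mult[of q w] by (simp add: mult.commute)
  then have "w\<^sup>2 + w * w1 + w1\<^sup>2 = w\<^sup>2 * (w ^ (2 * (q - 1)) + w ^ (q - 1) + 1)"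
    unfolding mult.commute[of 2] power_mult by (simp add: algebra_simps power2_eq_square)
  then have e: "w\<^sup>2 + w * w1 + w1\<^sup>2 \<noteq> 0" using w by simp
  define y E N where "y = 1 + w"
    and "E = y * y ^ q + y * (y ^ q) ^ q + y ^ q * (y ^ q) ^ q"
    and "N = y * y ^ q * (y ^ q) ^ q"
  have conj: "y ^ q = 1 + w1" "(1 + w1) ^ q = 1 + w2"
    by (simp_all add: y_def w1_def w2_def frob)
  have "2 + 1 = (1 :: 'a)" "2 * 2 = (0 :: 'a)" unfolding two by simp_all
  then have three: "3 = (1 :: 'a)" and four: "4 = (0 :: 'a)" by simp_all
  have tr_y: "tr y = 1"
    unfolding tr_conjugates conj sum by (simp add: y_def three)
  then have "y \<noteq> 0" by auto
  then have N0: "N \<noteq> 0" by (simp add: N_def)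
  have "E = 3 - (w\<^sup>2 + w * w1 + w1\<^sup>2)"
    unfolding E_def conj sum by (simp add: y_def algebra_simps power2_eq_square)
  then have "E - 1 = - (w\<^sup>2 + w * w1 + w1\<^sup>2)" unfolding three by simp
  then have E1: "E - 1 \<noteq> 0" using e by (simp only: neg_equal_0_iff_equal not_False_eq_True)
  \<comment> \<open>With 2 = 4 = 0 and 3 = 1 the criterion reads \<open>t^4 * N^2 = E - 1\<close>,
    so a fourth root of \<open>v\<close> in the fixed field is wanted.\<close>
  define v where "v = (E - 1) / N\<^sup>2"
  have "v ^ q = v"
    unfolding v_def E_def N_def
    by (simp add: frob power_divide frob_power [of _ 2] frob_cubed) (simp add: ac_simps)
  \<comment> \<open>As \<open>q\<close> is even, \<open>4 * (q div 2)^2 = q^2\<close>, and Frobenius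
    applied twice fixes \<open>v\<close>.\<close>
  define t where "t = v ^ (q div 2)\<^sup>2"
  have "t ^ 4 = v ^ q\<^sup>2"
    using even unfolding t_def power_mult [symmetric] by (auto elim!: evenE simp: power2_eq_square ac_simps)
  also have "\<dots> = v" using \<open>v ^ q = v\<close> by (simp flip: frob_frob)
  finally have t4: "t ^ 4 = v" .
  have "t ^ q = t" unfolding t_def frob_power \<open>v ^ q = v\<close> ..
  moreover have "t \<noteq> 0" using E1 N0 by (simp add: t_def v_def)
  moreover have "3 * (t\<^sup>2)\<^sup>2 * N\<^sup>2 + 2 * t\<^sup>2 * (E\<^sup>2 - 2 * N - N * E) + 1 - 3 * E + 4 * N = 0"
  proof -
    have "(t\<^sup>2)\<^sup>2 = v" using t4 by simp
    then show ?thesis using N0 by (simp add: two three four v_def)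
  qed
  ultimately show ?thesis
    using not_bij_hI[OF tr_y _ _ E_def N_def] by blast
qed

section \<open>Characteristic at least 5\<close>

text \<open>On the prime field the trace is multiplication by 3, so \<open>h\<close> becomes
  \<open>3 / x + 2 * x\<close>, which takes equal values at \<open>x\<close> and
  \<open>3 / (2 * x)\<close>; \<open>x = 1\<close> gives the collision.\<close>

lemma not_bij_h_char_ge_5:
  assumes two: "(2 :: 'a) \<noteq> 0" and three: "(3 :: 'a) \<noteq> 0"
  shows "\<not> bij_betw (h q :: 'a \<Rightarrow> 'a) (UNIV - {0}) (UNIV - {0})"
proof
  assume "bij_betw (h q :: 'a \<Rightarrow> 'a) (UNIV - {0}) (UNIV - {0})"
  then have inj: "inj_on (h q :: 'a \<Rightarrow> 'a) (UNIV - {0})" by (simp add: bij_betw_def)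
  define c :: 'a where "c = 2 / 3"
  have "c ^ q = c" by (simp add: c_def power_divide)
  then have "tr c = 3 * c" by (simp add: tr_conjugates)
  also have "3 * c = 2" using three by (simp add: c_def)
  also have "c = 1 / (3 / 2)" by (simp add: c_def)
  finally have tr_2: "tr (1 / (3 / 2)) = 2" .
  define x :: 'a where "x = 3 / 2"
  have "2 * x = 3" using two by (simp add: x_def)
  have "(1 + x\<^sup>2) * 2 - x = 2 + (2 * x) * x - x"
    by (simp add: algebra_simps power2_eq_square)
  also have "\<dots> = 2 + 2 * x" unfolding \<open>2 * x = 3\<close> using \<open>2 * x = 3\<close> by (simp add: algebra_simps)
  finally have "(1 + x\<^sup>2) * 2 - x = 5" using \<open>2 * x = 3\<close> by simp
  then have "h q (3 / 2 :: 'a) = 5"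
    unfolding h_def tr_2 by (simp only: x_def)
  moreover have "h q (1 :: 'a) = 5"
    by (simp add: h_def tr_conjugates)
  ultimately have "(1 :: 'a) = 3 / 2"
    using inj_onD[OF inj, of 1 "3 / 2"] two three by simp
  then have "(3 :: 'a) - 2 = 0" using two by simp
  then show False by simp
qed

section \<open>Characteristic 3, \<open>q\<close> different from 3\<close>

text \<open>Each fibre of \<open>u^q - u\<close> is a translate of its kernel, the fixed field, and
  the image has \<open>q^2\<close> of the \<open>q^3\<close> elements.\<close>

lemma card_fixed_ge: "q \<le> card {u :: 'a. u ^ q = u}"
proof -
  let ?f = "\<lambda>u :: 'a. u ^ q - u" and ?K = "{u :: 'a. u ^ q = u}"
  have fibre: "card {u. ?f u = ?f u0} \<le> card ?K" for u0
    by (rule card_inj_on_le[of "\<lambda>u. u - u0"]) (auto simp: inj_on_def frob_diff algebra_simps)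
  have "q ^ 3 \<le> card (range ?f) * card ?K"
    unfolding card_UNIV [symmetric] by (rule card_UNIV_le_range) (rule fibre)
  also have "card (range ?f) = q\<^sup>2"
    using card_ker_tr unfolding ker_tr .
  finally show ?thesis
    using q_gt_1 by (simp add: power2_eq_square power3_eq_cube)
qed

text \<open>The element \<open>c - u\<^sup>2\<close> has trace 1, second symmetric function \<open>1 - c\<close> and norm
  \<open>c\<^sup>3 + c\<^sup>2 + c - (u - u\<^sup>3)\<^sup>2\<close>, which turns the condition of \<open>not_bij_hI\<close> into \<open>eq\<close>.\<close>

lemma not_bij_h_char_3I:
  fixes u c t :: 'a
  assumes three: "(3 :: 'a) = 0" and u: "u ^ q = u + 1" and c: "c ^ q = c"
    and t: "t \<noteq> 0" "t ^ q = t" and g: "g = u - u ^ 3"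
    and eq: "t\<^sup>2 * (c ^ 4 + c ^ 3 + 2 * c\<^sup>2 + c + 1 - c * g\<^sup>2) = c ^ 3 + c\<^sup>2 + c + 1 - g\<^sup>2"
  shows "\<not> bij_betw (h q :: 'a \<Rightarrow> 'a) (UNIV - {0}) (UNIV - {0})"
proof -
  define y where "y = c - u\<^sup>2"
  have yq: "y ^ q = c - (u + 1)\<^sup>2"
    by (simp only: y_def frob_diff frob_power[of _ 2] u c)
  have yqq: "(c - (u + 1)\<^sup>2) ^ q = c - (u + 2)\<^sup>2"
    by (simp add: frob_diff frob_add frob_power[of _ 2] u c add.assoc)
  \<comment> \<open>This and the expansions below are identities over every commutative ring, with a
    multiple of 3 split off so that \<open>three\<close> can remove it.\<close>
  have "tr y = 1 + 3 * (c - u\<^sup>2 - 2 * u - 2)"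
    unfolding tr_conjugates yq yqq by (simp add: y_def algebra_simps power2_eq_square)
  then have tr_y: "tr y = 1" by (simp add: three)
  define E N where "E = y * y ^ q + y * (y ^ q) ^ q + y ^ q * (y ^ q) ^ q"
    and "N = y * y ^ q * (y ^ q) ^ q"
  have "E = 1 - c + 3 * (c\<^sup>2 - 2 * c * u\<^sup>2 - 4 * c * u - 3 * c + u ^ 4 + 4 * u ^ 3 + 6 * u\<^sup>2 + 4 * u + 1)"
    unfolding E_def yq yqq
    by (simp add: y_def algebra_simps power2_eq_square power3_eq_cube power4_eq_xxxx)
  then have E: "E = 1 - c" by (simp add: three)
  have "u * (u + 1) * (u + 2) = - g + 3 * (u\<^sup>2 + u)"
    unfolding g by (simp add: algebra_simps power2_eq_square power3_eq_cube)
  then have norm_u: "u * (u + 1) * (u + 2) = - g" by (simp add: three)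
  have "N = c ^ 3 + c\<^sup>2 + c - (u * (u + 1) * (u + 2))\<^sup>2
      + 3 * (c * (u ^ 4 + 4 * u ^ 3 + 6 * u\<^sup>2 + 4 * u + 1) - c\<^sup>2 * (u\<^sup>2 + 2 * u + 2))"
    unfolding N_def yq yqq
    by (simp add: y_def algebra_simps power2_eq_square power3_eq_cube power4_eq_xxxx)
  then have N: "N = c ^ 3 + c\<^sup>2 + c - g\<^sup>2" by (simp add: three norm_u)
  have "E\<^sup>2 - 2 * N - N * E = c ^ 4 + c ^ 3 + 2 * c\<^sup>2 + c + 1 - c * g\<^sup>2 - 3 * (c + N)"
    unfolding E N by (simp add: algebra_simps power2_eq_square power3_eq_cube power4_eq_xxxx)
  then have "E\<^sup>2 - 2 * N - N * E = c ^ 4 + c ^ 3 + 2 * c\<^sup>2 + c + 1 - c * g\<^sup>2"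
    by (simp only: three mult_zero_left diff_zero)
  moreover have "c ^ 3 + c\<^sup>2 + c + 1 - g\<^sup>2 = N + 1" by (simp add: N)
  ultimately have "t\<^sup>2 * (E\<^sup>2 - 2 * N - N * E) = N + 1"
    using eq by (simp only:)
  \<comment> \<open>Modulo 3 the criterion is linear in \<open>t^2\<close>; after inserting
    \<open>N + 1\<close> it is a multiple of 3.\<close>
  then have "3 * (t\<^sup>2)\<^sup>2 * N\<^sup>2 + 2 * t\<^sup>2 * (E\<^sup>2 - 2 * N - N * E) + 1 - 3 * E + 4 * N
      = 3 * ((t\<^sup>2)\<^sup>2 * N\<^sup>2 + 1 - E + 2 * N)"
    unfolding mult.assoc[of 2] by (simp add: algebra_simps)
  then show ?thesis
    using not_bij_hI[OF tr_y t E_def N_def] by (simp add: three)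
qed

text \<open>Write \<open>q^3 = 8 * m + 1\<close>. Not all \<open>8 * m\<close> nonzero elements are
  roots of \<open>X^(4 * m) - 1\<close>, and a non-root \<open>v\<close> has
  \<open>v^(4 * m) = -1\<close>. Then \<open>t = v^m\<close> has \<open>t^8 = 1\<close>, so
  \<open>q mod 8 = 1\<close> makes it fixed by Frobenius.\<close>

lemma primitive_8th_root_exists:
  assumes "q mod 8 = 1"
  shows "\<exists>t :: 'a. t ^ 4 = -1 \<and> t ^ q = t"
proof -
  have "q ^ 3 mod 8 = 1"
    using assms by (metis power_mod power_one mod_less one_less_numeral_iff semiring_norm(76))
  then obtain m where m: "q ^ 3 = 8 * m + 1"
    by (metis mult_div_mod_eq)
  have "m > 0" using m q_gt_1 by (cases m) auto
  obtain v :: 'a where v: "v \<noteq> 0" "v ^ (4 * m) \<noteq> 1"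
  proof (rule ccontr)
    assume "\<not> thesis"
    then have *: "\<And>v :: 'a. v \<in> UNIV - {0} \<Longrightarrow> v ^ (4 * m) = 1" using that by blast
    let ?p = "monom 1 (4 * m) - 1 :: 'a poly"
    have "coeff ?p (4 * m) = 1" using \<open>m > 0\<close> by simp
    then have "?p \<noteq> 0" by (metis coeff_0 zero_neq_one)
    then have "card (UNIV - {0 :: 'a}) \<le> degree ?p"
      by (rule card_roots_le) (use * in \<open>simp add: poly_monom\<close>)
    also have "\<dots> \<le> 4 * m"
      by (intro degree_diff_le) (auto intro: order.trans[OF degree_monom_le])
    finally show False using m \<open>m > 0\<close> by (simp add: card_Diff_subset card_UNIV)
  qed
  have "(v ^ (4 * m))\<^sup>2 = v ^ (q ^ 3 - 1)"
    by (simp add: m power_mult [symmetric])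
  also have "\<dots> = 1"
    using finite_field_power_card_minus_1[OF v(1)] by (simp add: card_UNIV)
  finally have "v ^ (4 * m) = -1"
    using v(2) by (simp add: power2_eq_1_iff)
  then have t4: "(v ^ m) ^ 4 = -1"
    by (simp add: power_mult [symmetric] mult.commute)
  have "(v ^ m) ^ q = (v ^ m) ^ (8 * (q div 8) + 1)"
    using assms by (metis mult_div_mod_eq)
  also have "\<dots> = (((v ^ m) ^ 4)\<^sup>2) ^ (q div 8) * v ^ m"
    by (simp add: power_mult [symmetric] power_add ac_simps)
  also have "\<dots> = v ^ m" by (simp add: t4)
  finally show ?thesis using t4 by blast
qed

lemma not_bij_h_char_3:
  assumes three: "(3 :: 'a) = 0" and "q \<noteq> 3"
  shows "\<not> bij_betw (h q :: 'a \<Rightarrow> 'a) (UNIV - {0}) (UNIV - {0})"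
proof -
  have two: "(2 :: 'a) \<noteq> 0"
  proof
    assume "2 = (0 :: 'a)"
    have "(1 :: 'a) = 3 - 2" by simp
    also have "\<dots> = 0" unfolding three \<open>2 = 0\<close> by simp
    finally show False by simp
  qed
  have "CHAR('a) dvd 3"
    using three of_nat_eq_0_iff_char_dvd[of 3, where ?'a = 'a] by simp
  then have char: "CHAR('a) = 3"
    using prime_CHAR primes_dvd_imp_eq[of "CHAR('a)" 3] by simp
  obtain k where k: "k > 0" "q = 3 ^ k" using q_CHAR_power char by auto
  have "tr 1 = 0" using three by (simp add: tr_conjugates)
  then have "1 \<in> range (\<lambda>u :: 'a. u ^ q - u)" by (simp flip: ker_tr)
  then obtain u :: 'a where "1 = u ^ q - u" by (rule rangeE)
  then have u: "u ^ q = u + 1" by (simp add: algebra_simps)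
  show ?thesis
  proof (cases "even k")
    case True
    then obtain j where "k = 2 * j" by blast
    then have "q mod 8 = 9 ^ j mod 8" using k by (simp add: power_mult)
    also have "\<dots> = 1" using power_mod[of "9 :: nat" 8 j] by simp
    finally obtain t :: 'a where t: "t ^ 4 = -1" "t ^ q = t"
      using primitive_8th_root_exists by blast
    \<comment> \<open>Since \<open>c^2 = -1\<close>, all terms without \<open>g\<close> cancel on
      both sides of the condition, and what remains holds for every \<open>g\<close>.\<close>
    define c where "c = - t\<^sup>2"
    have c: "c ^ q = c" by (simp add: c_def frob_minus frob_power[of _ 2] t)
    have t2: "t\<^sup>2 = - c" by (simp add: c_def)
    have c2: "c\<^sup>2 = -1" using t(1) by (simp add: c_def)
    have c3: "c ^ 3 = - c" and c4: "c ^ 4 = 1"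
      using c2 by (simp_all add: power3_eq_cube power4_eq_xxxx power2_eq_square)
    have "t\<^sup>2 * (c ^ 4 + c ^ 3 + 2 * c\<^sup>2 + c + 1 - c * g\<^sup>2) = c\<^sup>2 * g\<^sup>2" for g
      unfolding t2 c3 c4 c2 by (simp add: c2 flip: mult.assoc power2_eq_square)
    moreover have "c ^ 3 + c\<^sup>2 + c + 1 - g\<^sup>2 = c\<^sup>2 * g\<^sup>2" for g
      by (simp add: c2 c3)
    moreover have "t \<noteq> 0" using t(1) by auto
    ultimately show ?thesis
      using not_bij_h_char_3I[OF three u c _ t(2) refl] by simp
  next
    case False
    then obtain j where j: "k = 2 * j + 1" by (elim oddE)
    have "j > 0" using j k \<open>q \<noteq> 3\<close> by (cases j) auto
    then have "q \<ge> 3 ^ 3"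
      unfolding k(2) j by (intro power_increasing) auto
    have "q mod 4 = 9 ^ j * 3 mod 4" unfolding k j power_add power_mult by simp
    also have "\<dots> = 3"
      using power_mod[of "9 :: nat" 4 j] mod_mult_left_eq[of "9 ^ j" 4 "3 :: nat"] by simp
    finally have q4: "2 * (2 * ((q + 1) div 4)) = q + 1" by presburger
    \<comment> \<open>The solutions of \<open>u^q = u + 1\<close> form a coset of the fixed field,
      so there are at least 27, too many for the degree 6 polynomial \<open>(X - X^3)^2 - 1\<close>.
      This makes \<open>v\<close> below nonzero.\<close>
    obtain u where u: "u ^ q = u + 1" and g1: "(u - u ^ 3)\<^sup>2 \<noteq> (1 :: 'a)"
    proof (rule ccontr)
      assume "\<not> thesis"
      then have *: "\<And>u :: 'a. u ^ q = u + 1 \<Longrightarrow> (u - u ^ 3)\<^sup>2 = 1" using that by blast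
      let ?p = "[:-1, 0, 1, 0, -2, 0, 1:] :: 'a poly"
      have "q \<le> card ((+) u ` {z. z ^ q = z})"
        using card_fixed_ge by (simp add: card_image)
      also have "\<dots> \<le> degree ?p"
      proof (rule card_roots_le)
        fix x assume "x \<in> (+) u ` {z. z ^ q = z}"
        then have "x ^ q = x + 1" by (auto simp: frob_add u)
        then have "(x - x ^ 3)\<^sup>2 = 1" by (rule *)
        then show "poly ?p x = 0"
          by (simp add: algebra_simps power2_eq_square power3_eq_cube)
      qed simp
      finally show False using \<open>q \<ge> 3 ^ 3\<close> by simp
    qed
    define g where "g = u - u ^ 3"
    have "g ^ q = g - 3 * (u\<^sup>2 + u)"
      by (simp add: g_def frob_diff frob_power[of _ 3] u)
        (simp add: algebra_simps power2_eq_square power3_eq_cube)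
    then have g: "g ^ q = g" by (simp add: three)
    define v where "v = 1 - g\<^sup>2"
    have v: "v \<noteq> 0" "v ^ q = v"
      using g1 by (simp_all add: v_def g_def [symmetric] frob_diff frob_power[of _ 2] g)
    \<comment> \<open>As \<open>q mod 4 = 3\<close>, \<open>t^4 = v^(q + 1) = v^2\<close>; thus
      \<open>t\<close> is a square root of \<open>v\<close> or of \<open>-v\<close>.\<close>
    define t where "t = v ^ ((q + 1) div 4)"
    have t: "t \<noteq> 0" "t ^ q = t"
      unfolding t_def frob_power[of _ "(q + 1) div 4"] v(2) using v(1) by simp_all
    have "(t\<^sup>2)\<^sup>2 = v ^ (2 * (2 * ((q + 1) div 4)))"
      by (simp only: t_def power_mult [symmetric] ac_simps)
    also have "\<dots> = v\<^sup>2" unfolding q4 using v(2) by (simp add: power2_eq_square)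
    finally consider "t\<^sup>2 = v" | "t\<^sup>2 = - v"
      unfolding power2_eq_iff by blast
    \<comment> \<open>With \<open>c = 0\<close> the condition is \<open>t^2 = 1 - g^2 = v\<close>.
      With \<open>c = 1\<close> and \<open>t / g\<close> in place of \<open>t\<close> it is
      \<open>(t / g)^2 * (6 - g^2) = 4 - g^2\<close>, that is \<open>t^2 = -v\<close>.\<close>
    then show ?thesis
    proof cases
      case 1
      show ?thesis
        by (rule not_bij_h_char_3I[OF three u _ t g_def, of 0]) (use q_gt_1 1 in \<open>simp_all add: v_def power_0_left\<close>)
    next
      case 2
      have g0: "g \<noteq> 0"
      proof
        assume "g = 0"
        then have "v = 1" by (simp add: v_def)
        then have "t = 1" by (simp add: t_def)
        with 2 \<open>v = 1\<close> have "1 + 1 = (0 :: 'a)" by (simp add: eq_neg_iff_add_eq_0)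
        then show False using two by simp
      qed
      have tg: "(t / g)\<^sup>2 * (3 * 2 - g\<^sup>2) = v"
        using g0 2 by (simp add: three power_divide)
      have "(t / g)\<^sup>2 * (1 ^ 4 + 1 ^ 3 + 2 * 1\<^sup>2 + 1 + 1 - 1 * g\<^sup>2) = 1 ^ 3 + 1\<^sup>2 + 1 + 1 - g\<^sup>2"
      proof -
        have "(1 ^ 3 + 1\<^sup>2 + 1 + 1 - g\<^sup>2 :: 'a) = 3 + v" by (simp add: v_def)
        also have "\<dots> = v" by (simp add: three)
        finally show ?thesis using tg by simp
      qed
      moreover have "t / g \<noteq> 0" "(t / g) ^ q = t / g"
        using t g g0 by (simp_all add: power_divide)
      ultimately show ?thesis
        using not_bij_h_char_3I[OF three u _ _ _ g_def, of 1 "t / g"] by simp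
    qed
  qed
qed

text \<open>Clearing denominators; a condition on the trace of \<open>1 / x\<close> becomes one on
  the second symmetric function and the norm of \<open>x\<close>.\<close>

lemma tr_inverse:
  assumes "x \<noteq> 0"
  shows "tr (1 / x) * (x * x ^ q * (x ^ q) ^ q) = x * x ^ q + x * (x ^ q) ^ q + x ^ q * (x ^ q) ^ q"
  unfolding tr_conjugates using assms by (simp add: power_divide field_simps)

end

section \<open>The case \<open>q = 3\<close>: the field of 27 elements\<close>

locale cubic_extension_3 = cubic_extension 3 ty for ty :: "'a::{field,finite} itself"
begin

lemma three: "(3 :: 'a) = 0"
  using q_CHAR_power of_nat_eq_0_iff_char_dvd[of 3, where ?'a = 'a] by (metis dvd_power of_nat_numeral)

lemma two: "(2 :: 'a) = - 1"
proof -
  have "(2 :: 'a) = 3 - 1" by simp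
  then show ?thesis unfolding three by simp
qed

lemma fixed_cases:
  fixes x :: 'a
  assumes "x ^ 3 = x"
  obtains "x = 0" | "x = 1" | "x = - 1"
proof -
  have "x * ((x - 1) * (x + 1)) = 0"
    using assms by (simp add: algebra_simps power3_eq_cube)
  then show ?thesis using that by (auto simp: eq_neg_iff_add_eq_0)
qed

lemma tr_fixed: "(tr y) ^ 3 = tr y"
  by (simp only: tr_conjugates frob_add frob_cubed) (simp add: ac_simps)

lemma tr_inverse_minus_one: "tr (1 / - 1) = 0"
  by (simp add: tr_conjugates three)

lemma symmetric_functions:
  fixes x y z a b :: 'a
  assumes x: "x \<noteq> 0" "tr (1 / x) = 1" and yz: "y = x ^ 3" "z = y ^ 3"
    and a: "a = x + y + z" and b: "b = x * y * z"
  shows "x * y + x * z + y * z = b" "a ^ 3 = a" "b ^ 3 = b" "b \<noteq> 0"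
proof -
  have zx: "z ^ 3 = x" unfolding yz by (rule frob_cubed)
  show "x * y + x * z + y * z = b"
    using tr_inverse[OF x(1)] x(2) unfolding b yz by simp
  show "a ^ 3 = a"
    unfolding a frob_add zx yz(1) [symmetric] yz(2) [symmetric] by (simp add: ac_simps)
  show "b ^ 3 = b"
    unfolding b power_mult_distrib zx yz(1) [symmetric] yz(2) [symmetric] by (simp add: ac_simps)
  show "b \<noteq> 0" using x(1) by (simp add: b yz)
qed

text \<open>Equality of second symmetric function and norm, for both \<open>x\<close> and
  \<open>1 - x\<close>, gives \<open>b = a - 2\<close>. Then \<open>1 + x\<close> has norm
  \<open>3 * (a - 1) = 0\<close>, so \<open>x = -1\<close>, whose inverse has trace 0.\<close>

lemma tr_inverse_reflection:
  fixes x :: 'a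
  assumes x: "x \<noteq> 0" "tr (1 / x) = 1" and x': "1 - x \<noteq> 0" "tr (1 / (1 - x)) = 1"
  shows False
proof -
  define y z where yz: "y = x ^ 3" "z = y ^ 3"
  define a b where a: "a = x + y + z" and b: "b = x * y * z"
  note e2 = symmetric_functions(1)[OF x yz a b]
  have conj: "(1 - x) ^ 3 = 1 - y" "(1 - y) ^ 3 = 1 - z"
    by (simp_all only: frob_diff power_one yz)
  have "(1 - x) * (1 - y) * (1 - z) = (1 - x) * (1 - y) + (1 - x) * (1 - z) + (1 - y) * (1 - z)"
    using tr_inverse[OF x'(1)] x'(2) unfolding conj by simp
  moreover have "(1 - x) * (1 - y) * (1 - z) = 1 - a + (x * y + x * z + y * z) - b"
    by (simp add: a b algebra_simps)
  moreover have "(1 - x) * (1 - y) + (1 - x) * (1 - z) + (1 - y) * (1 - z)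
      = 3 - 2 * a + (x * y + x * z + y * z)"
    by (simp add: a algebra_simps)
  ultimately have "1 - a = 3 - 2 * a + b" unfolding e2 by simp
  then have b_eq: "b = a - 2" by (simp add: algebra_simps)
  have "(1 + x) * (1 + y) * (1 + z) = 1 + a + (x * y + x * z + y * z) + b"
    by (simp add: a b algebra_simps)
  also have "\<dots> = 3 * (a - 1)" unfolding e2 b_eq by (simp add: algebra_simps)
  also have "\<dots> = 0" by (simp add: three)
  finally have "(1 + x) * (1 + x) ^ 3 * ((1 + x) ^ 3) ^ 3 = 0"
    by (simp only: frob_add power_one yz)
  then have "x = - 1" by (auto simp: eq_neg_iff_add_eq_0 add.commute)
  then show False using x(2) tr_inverse_minus_one by simp
qed

text \<open>Trace 0 would mean \<open>b^2 - a^2 + a = 0\<close> modulo 3. Here \<open>b\<close> is 1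
  or -1, and \<open>1 - a^2 + a\<close> has no root among 0, 1, -1.\<close>

lemma tr_inverse_square_nonzero:
  fixes x :: 'a
  assumes x: "x \<noteq> 0" "tr (1 / x) = 1"
  shows "1 + x \<noteq> 0" "tr (1 / (1 + x)\<^sup>2) \<noteq> 0"
proof -
  show nz: "1 + x \<noteq> 0"
  proof
    assume "1 + x = 0"
    then have "x = - 1" by (simp add: eq_neg_iff_add_eq_0 add.commute)
    then show False using x(2) tr_inverse_minus_one by simp
  qed
  define y z where yz: "y = x ^ 3" "z = y ^ 3"
  define a b where a: "a = x + y + z" and b: "b = x * y * z"
  note sym = symmetric_functions[OF x yz a b]
  have conj: "((1 + x)\<^sup>2) ^ 3 = (1 + y)\<^sup>2" "((1 + y)\<^sup>2) ^ 3 = (1 + z)\<^sup>2"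
    by (simp_all only: frob_power[of _ 2] frob_add power_one yz)
  define E1 E2 E3 where "E1 = (1 + x) + (1 + y) + (1 + z)"
    and "E2 = (1 + x) * (1 + y) + (1 + x) * (1 + z) + (1 + y) * (1 + z)"
    and "E3 = (1 + x) * (1 + y) * (1 + z)"
  have "E1 = a + 3" by (simp add: E1_def a algebra_simps)
  moreover have "E2 = (x * y + x * z + y * z) + 2 * a + 3"
    by (simp add: E2_def a algebra_simps)
  moreover have "E3 = 1 + a + (x * y + x * z + y * z) + b"
    by (simp add: E3_def a b algebra_simps)
  ultimately have E: "E1 = a + 3" "E2 = b + 2 * a + 3" "E3 = 1 + a + b + b"
    unfolding sym(1) by simp_all
  show "tr (1 / (1 + x)\<^sup>2) \<noteq> 0"
  proof
    assume "tr (1 / (1 + x)\<^sup>2) = 0"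
    then have "(1 + x)\<^sup>2 * (1 + y)\<^sup>2 + (1 + x)\<^sup>2 * (1 + z)\<^sup>2 + (1 + y)\<^sup>2 * (1 + z)\<^sup>2 = 0"
      using tr_inverse[of "(1 + x)\<^sup>2"] nz unfolding conj by simp
    moreover have "p\<^sup>2 * r\<^sup>2 + p\<^sup>2 * s\<^sup>2 + r\<^sup>2 * s\<^sup>2
        = (p * r + p * s + r * s)\<^sup>2 - 2 * (p + r + s) * (p * r * s)" for p r s :: 'a
      by (simp add: algebra_simps power2_eq_square)
    ultimately have "E2\<^sup>2 - 2 * E1 * E3 = 0"
      by (simp only: E1_def E2_def E3_def)
    moreover have "E2\<^sup>2 - 2 * E1 * E3 = b\<^sup>2 - a\<^sup>2 + a + 3 * (a\<^sup>2 + 1 - 2 * b + a)"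
      unfolding E by (simp add: algebra_simps power2_eq_square)
    ultimately have "b\<^sup>2 - a\<^sup>2 + a = 0" by (simp only: three mult_zero_left add_0_right)
    moreover have "b\<^sup>2 = 1"
      by (rule fixed_cases[OF sym(3)]) (use sym(4) in simp_all)
    ultimately have a_eq: "1 - a\<^sup>2 + a = 0" by simp
    show False
      by (rule fixed_cases[OF sym(2)]) (use a_eq in simp_all)
  qed
qed

text \<open>The exponent 27 is \<open>2 * 13 + 1\<close> with 13 odd, so
  \<open>j = j^27 = -j\<close>.\<close>

lemma minus_one_not_square: "(j :: 'a)\<^sup>2 \<noteq> - 1"
proof
  assume "j\<^sup>2 = - 1"
  have "j = j ^ (2 * 13 + 1)" using power_q_cubed[of j] by simp
  also have "\<dots> = (j\<^sup>2) ^ 13 * j" unfolding power_add power_mult by simp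
  also have "\<dots> = - j" by (simp add: \<open>j\<^sup>2 = - 1\<close>)
  finally have "2 * j = 0" by (simp add: eq_neg_iff_add_eq_0)
  then show False using \<open>j\<^sup>2 = - 1\<close> by (simp add: two)
qed

lemma h_minus: "h 3 (- x :: 'a) = - h 3 x"
  using tr_minus[of "1 / x"] by (simp add: h_def algebra_simps)

lemma h_eq_of_tr:
  shows "tr (1 / x) = 0 \<Longrightarrow> h 3 x = - x"
    and "tr (1 / x) = 1 \<Longrightarrow> h 3 x = (1 + x)\<^sup>2"
proof -
  assume "tr (1 / x) = 1"
  then have "h 3 x = (1 + x)\<^sup>2 - 3 * x"
    by (simp add: h_def algebra_simps power2_eq_square)
  then show "h 3 x = (1 + x)\<^sup>2" by (simp add: three)
qed (simp add: h_def)

text \<open>Trace -1 is stated through \<open>- y\<close> so that oddness of \<open>h\<close>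
  reduces it to trace 1.\<close>

lemma tr_cases:
  obtains "tr y = 0" | "tr y = 1" | "tr (- y) = 1"
proof (rule fixed_cases[OF tr_fixed[of y]])
  assume "tr y = - 1"
  then show ?thesis using that(3) by (simp add: tr_minus)
qed (use that in blast)+

lemma h_nonzero:
  assumes "(x :: 'a) \<noteq> 0"
  shows "h 3 x \<noteq> 0"
proof (cases rule: tr_cases[of "1 / x"])
  case 1
  then show ?thesis using h_eq_of_tr(1) assms by simp
next
  case 2
  then show ?thesis using h_eq_of_tr(2) tr_inverse_square_nonzero(1) assms by simp
next
  case 3
  then have "h 3 (- x) = (1 - x)\<^sup>2" "1 - x \<noteq> 0"
    using h_eq_of_tr(2)[of "- x"] tr_inverse_square_nonzero(1)[of "- x"] assms by simp_all
  then show ?thesis using h_minus[of x] by auto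
qed

text \<open>By the trace of \<open>1 / x'\<close>: trace 0 contradicts
  \<open>tr_inverse_square_nonzero\<close>; trace 1 leaves \<open>x' = x\<close> or
  \<open>x' = 1 - x\<close>, the latter excluded by \<open>tr_inverse_reflection\<close>; trace -1
  would make -1 a square.\<close>

lemma h_inj_of_tr_1:
  fixes x x' :: 'a
  assumes x: "x \<noteq> 0" "tr (1 / x) = 1" and x': "x' \<noteq> 0" and eq: "h 3 x = h 3 x'"
  shows "x = x'"
proof (cases rule: tr_cases[of "1 / x'"])
  case 1
  then have "x' = - (1 + x)\<^sup>2"
    using eq h_eq_of_tr(2)[OF x(2)] h_eq_of_tr(1)[of x'] by simp
  then have "tr (1 / x') = - tr (1 / (1 + x)\<^sup>2)"
    using tr_minus[of "1 / (1 + x)\<^sup>2"] by simp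
  then show ?thesis using 1 tr_inverse_square_nonzero(2)[OF x] by simp
next
  case 2
  then have "(1 + x)\<^sup>2 = (1 + x')\<^sup>2"
    using eq h_eq_of_tr(2) x(2) by simp
  then consider "1 + x = 1 + x'" | "1 + x = - (1 + x')" by (auto simp: power2_eq_iff)
  then show ?thesis
  proof cases
    case 2
    have "x' = - (1 + x) - 1" unfolding 2 by simp
    also have "\<dots> = 1 - x - 3" by simp
    finally have "x' = 1 - x" by (simp add: three)
    then show ?thesis using tr_inverse_reflection[OF x] x' \<open>tr (1 / x') = 1\<close> by simp
  qed simp
next
  case 3
  then have "h 3 (- x') = (1 - x')\<^sup>2"
    using h_eq_of_tr(2)[of "- x'"] by simp
  then have "(1 - x')\<^sup>2 = - ((1 + x)\<^sup>2)"
    using eq h_eq_of_tr(2)[OF x(2)] by (simp add: h_minus)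
  then have "((1 - x') / (1 + x))\<^sup>2 = - 1"
    using tr_inverse_square_nonzero(1)[OF x] by (simp add: power_divide)
  then show ?thesis using minus_one_not_square by blast
qed

text \<open>If either inverse has nonzero trace, swapping the points or changing both signs reduces
  to \<open>h_inj_of_tr_1\<close>; otherwise \<open>h\<close> is negation at both.\<close>

lemma h_inj:
  fixes x x' :: 'a
  assumes x: "x \<noteq> 0" and x': "x' \<noteq> 0" and eq: "h 3 x = h 3 x'"
  shows "x = x'"
proof -
  have minus: "h 3 (- x) = h 3 (- x')" using eq by (simp add: h_minus)
  show ?thesis
  proof (cases rule: tr_cases[of "1 / x"])
    case 1
    note tr_x = 1
    show ?thesis
    proof (cases rule: tr_cases[of "1 / x'"])
      case 1
      then show ?thesis using h_eq_of_tr(1) tr_x eq by simp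
    next
      case 2
      then show ?thesis using h_inj_of_tr_1[of x' x] x x' eq by simp
    next
      case 3
      then show ?thesis using h_inj_of_tr_1[of "- x'" "- x"] x x' minus by simp
    qed
  next
    case 2
    then show ?thesis using h_inj_of_tr_1[OF x _ x' eq] by simp
  next
    case 3
    then show ?thesis using h_inj_of_tr_1[of "- x" "- x'"] x x' minus by simp
  qed
qed

lemma bij_h: "bij_betw (h 3 :: 'a \<Rightarrow> 'a) (UNIV - {0}) (UNIV - {0})"
proof -
  have "inj_on (h 3 :: 'a \<Rightarrow> 'a) (UNIV - {0})"
    using h_inj by (auto intro: inj_onI)
  moreover have "h 3 ` (UNIV - {0 :: 'a}) \<subseteq> UNIV - {0}"
    using h_nonzero by auto
  ultimately show ?thesis
    by (simp add: bij_betw_def endo_inj_surj)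
qed

end

theorem theorem4p2:
  fixes q :: nat
  assumes "primepow q"
    and "card (UNIV :: 'a::{field, finite} set) = q ^ 3"
  shows "bij_betw (h q :: 'a \<Rightarrow> 'a) (UNIV - {0}) (UNIV - {0}) \<longleftrightarrow> q = 3"
proof
  interpret cubic_extension q "TYPE('a)"
    using assms by unfold_locales
  assume "bij_betw (h q :: 'a \<Rightarrow> 'a) (UNIV - {0}) (UNIV - {0})"
  then show "q = 3"
    using not_bij_h_char_2 not_bij_h_char_3 not_bij_h_char_ge_5 by blast
next
  assume "q = 3"
  interpret cubic_extension_3 "TYPE('a)"
    using assms \<open>q = 3\<close> by unfold_locales auto
  show "bij_betw (h q :: 'a \<Rightarrow> 'a) (UNIV - {0}) (UNIV - {0})"
    unfolding \<open>q = 3\<close> by (rule bij_h)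
qed

end
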